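(* Fix an integer $n\ge1$ and $\beta>0$. Assume $0\le s<d/2$, $\mu\in L^\infty\cap\mathcal P(\mathbb R^d)$, and $v:\mathbb R^d\to\mathbb R^d$ globally Lipschitz; if $s=0$, assume in addition $\int_{(\mathbb R^d)^2}|\log|x-y||\,d\mu^{\otimes2}(x,y)<\infty$. Let $a_{N,s}=\log(e+N)$ if $s=0$ and $a_{N,s}=N^{s/d}$ if $0<s<d$, and assume moreover that there are constants $C_{\mathrm{pw}}(\mu,v,n),C_{\mathrm{pt}}(\mu)<\infty$ such that, for every $N\ge1$ and every configuration $X_N$, $$|\mathsf A_n(v,X_N,\mu)|\le C_{\mathrm{pw}}(\mu,v,n)\Big(\mathsf F_N(X_N,\mu)+C_{\mathrm{pt}}(\mu)\frac{a_{N,s}}N\Big).$$ Then, for every $f_N\in\mathcal P((\mathbb R^d)^N)$, $$\Big|\mathbb E_{X_N\sim f_N}[N\mathsf A_n(v,X_N,\mu)]\Big|\le\min\Big\{C_{\beta,n,v}N\mathsf E_N(f_N,\mu)+C_{\beta,\mu,v,n},\ \ C_{\mathrm{pw}}(\mu,v,n)N\mathsf E_N(f_N,\mu)+C'_{\mathrm{pw}}(\mu,v,n)a_{N,s}\Big\},$$ where one may take $C'_{\mathrm{pw}}(\mu,v,n)=C_{\mathrm{pw}}(\mu,v,n)C_{\mathrm{pt}}(\mu)$.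
   Context: Fix a dimension $d\ge1$. $\mathcal P(E)$ denotes Borel probability measures on $E$; $\mu\in L^\infty\cap\mathcal P(\mathbb R^d)$ means $\mu$ has a bounded Lebesgue density. $\mathsf g(x)=-\log|x|$ if $s=0$ and $\mathsf g(x)=\frac1s|x|^{-s}$ if $0<s<d$. Set $h_\mu(x)=\int\mathsf g(x-y)d\mu(y)$, $I_\mu=\frac12\iint\mathsf g(x-y)d\mu d\mu$, $\tilde{\mathsf g}(x,y)=\mathsf g(x-y)-h_\mu(x)-h_\mu(y)+2I_\mu$. For $X_N=(x_1,\dots,x_N)$: $$\mathsf F_N(X_N,\mu)=\frac1{2N^2}\sum_{i\ne j}\tilde{\mathsf g}(x_i,x_j)-\frac1{N^2}\sum_ih_\mu(x_i)+\frac1NI_\mu,\quad\mathsf K_{N,\beta}(\mu)=\mathbb E_{\mu^{\otimes N}}[e^{-\beta N\mathsf F_N}],\quad d\mathbb Q_{N,\beta}(\mu)=\frac{e^{-\beta N\mathsf F_N}}{\mathsf K_{N,\beta}(\mu)}d\mu^{\otimes N}.$$ With $\mu_N=\frac1N\sum_i\delta_{x_i}$ and $\triangle$ the diagonal of $(\mathbb R^d)^2$, $\mathsf A_n(v,X_N,\mu)=\int_{(\mathbb R^d)^2\setminus\triangle}\nabla^{\otimes n}\mathsf g(x-y):(v(x)-v(y))^{\otimes n}\,d(\mu_N-\mu)^{\otimes2}(x,y)$. The modulated free energy is $\mathsf E_N(f_N,\mu)=\frac1{\beta N}\mathsf H(f_N|\mu^{\otimes N})+\mathbb E_{f_N}[\mathsf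 F_N(X_N,\mu)]$, $\mathsf H$ being relative entropy. Constants: $\varepsilon_{\beta,n}>0$ and $C_{\mathrm{em}}(\beta,\mu,v,n)<\infty$ are constants for which $\sup_{N\ge1}\mathbb E_{\mathbb Q_{N,\beta}(\mu)}[e^{\sigma\varepsilon_{\beta,n}N\mathsf A_n(v,X_N,\mu)}]\le C_{\mathrm{em}}(\beta,\mu,v,n)$ for both $\sigma\in\{\pm1\}$, $C_{\mathrm{ub}}(\beta,\mu)<\infty$ is a constant with $\sup_{N\ge1}\mathsf K_{N,\beta}(\mu)\le C_{\mathrm{ub}}(\beta,\mu)$ (all these exist under the stated hypotheses), $C_{\mathrm{pf}}=\max\{e,C_{\mathrm{ub}}\}$, $C_{\beta,n,v}=\beta/\varepsilon_{\beta,n}$, and $C_{\beta,\mu,v,n}=\varepsilon_{\beta,n}^{-1}(\log C_{\mathrm{pf}}(\beta,\mu)+\log C_{\mathrm{em}}(\beta,\mu,v,n))$. *)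

theory Defs
  imports "HOL-Probability.Probability"
begin

(* R^d is a type 'a :: euclidean_space with d = DIM('a), which is at least 1. *)

definition bounded_density :: "'a::euclidean_space measure \<Rightarrow> bool" where
  "bounded_density \<mu> \<longleftrightarrow>
     (\<exists>\<rho> C. \<rho> \<in> borel_measurable borel \<and> \<mu> = density lborel \<rho> \<and> (AE x in lborel. \<rho> x \<le> ennreal C))"

(* Real-valued kernel; its value at the origin carries no meaning. *)
definition riesz :: "real \<Rightarrow> 'a::euclidean_space \<Rightarrow> real" where
  "riesz s x = (if s = 0 then - ln (norm x) else (1 / s) * norm x powr (- s))"

(* The kernel with its value +oo at the origin, so that coinciding points have infinite energy. *)
definition riesz_ext :: "real \<Rightarrow> 'a::euclidean_space \<Rightarrow> ereal" where
  "riesz_ext s x = (if x = 0 then \<infinity> else ereal (riesz s x))"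

(* In the next two integrals the diagonal is a null set, since \<mu> has a density. *)
definition potential :: "real \<Rightarrow> 'a::euclidean_space measure \<Rightarrow> 'a \<Rightarrow> real" where
  "potential s \<mu> x = (\<integral>y. riesz s (x - y) \<partial>\<mu>)"

definition self_energy :: "real \<Rightarrow> 'a::euclidean_space measure \<Rightarrow> real" where
  "self_energy s \<mu> = 1 / 2 * (\<integral>p. riesz s (fst p - snd p) \<partial>(\<mu> \<Otimes>\<^sub>M \<mu>))"

definition g_tilde :: "real \<Rightarrow> 'a::euclidean_space measure \<Rightarrow> 'a \<Rightarrow> 'a \<Rightarrow> ereal" where
  "g_tilde s \<mu> x y =
     riesz_ext s (x - y) - ereal (potential s \<mu> x) - ereal (potential s \<mu> y) + ereal (2 * self_energy s \<mu>)"

(* (R^d)^N: configurations are families indexed by {..<N}. *)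
abbreviation config_space :: "nat \<Rightarrow> (nat \<Rightarrow> 'a::euclidean_space) measure" where
  "config_space N \<equiv> \<Pi>\<^sub>M i\<in>{..<N}. borel"

abbreviation tensor_power :: "nat \<Rightarrow> 'a::euclidean_space measure \<Rightarrow> (nat \<Rightarrow> 'a) measure" where
  "tensor_power N \<mu> \<equiv> \<Pi>\<^sub>M i\<in>{..<N}. \<mu>"

definition F_energy :: "real \<Rightarrow> nat \<Rightarrow> 'a::euclidean_space measure \<Rightarrow> (nat \<Rightarrow> 'a) \<Rightarrow> ereal" where
  "F_energy s N \<mu> X =
     ereal (1 / (2 * real N ^ 2)) * (\<Sum>i<N. \<Sum>j\<in>{..<N} - {i}. g_tilde s \<mu> (X i) (X j))
     - ereal (1 / real N ^ 2 * (\<Sum>i<N. potential s \<mu> (X i)))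
     + ereal (1 / real N * self_energy s \<mu>)"

definition exp_ereal :: "ereal \<Rightarrow> ennreal" where
  "exp_ereal x = (if x = \<infinity> then \<infinity> else if x = - \<infinity> then 0 else ennreal (exp (real_of_ereal x)))"

definition gibbs_weight ::
    "real \<Rightarrow> real \<Rightarrow> nat \<Rightarrow> 'a::euclidean_space measure \<Rightarrow> (nat \<Rightarrow> 'a) \<Rightarrow> ennreal" where
  "gibbs_weight s \<beta> N \<mu> X = exp_ereal (- (ereal (\<beta> * real N) * F_energy s N \<mu> X))"

definition K_partition :: "real \<Rightarrow> real \<Rightarrow> nat \<Rightarrow> 'a::euclidean_space measure \<Rightarrow> ennreal" where
  "K_partition s \<beta> N \<mu> = (\<integral>\<^sup>+X. gibbs_weight s \<beta> N \<mu> X \<partial>tensor_power N \<mu>)"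

definition Q_gibbs ::
    "real \<Rightarrow> real \<Rightarrow> nat \<Rightarrow> 'a::euclidean_space measure \<Rightarrow> (nat \<Rightarrow> 'a) measure" where
  "Q_gibbs s \<beta> N \<mu> =
     density (tensor_power N \<mu>) (\<lambda>X. gibbs_weight s \<beta> N \<mu> X / K_partition s \<beta> N \<mu>)"

(* (1/N) * sum of the Dirac masses at X 0, ..., X (N - 1), counted with multiplicity. *)
definition empirical :: "nat \<Rightarrow> (nat \<Rightarrow> 'a::euclidean_space) \<Rightarrow> 'a measure" where
  "empirical N X = distr (uniform_count_measure {..<N}) borel X"

definition partial_deriv :: "'a::euclidean_space \<Rightarrow> ('a \<Rightarrow> real) \<Rightarrow> 'a \<Rightarrow> real" where
  "partial_deriv b f z = deriv (\<lambda>t. f (z + t *\<^sub>R b)) 0"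

(* The n-th derivative tensor of f at z contracted with the n-fold tensor power of w: the lists bs
   are the multi-indices (i_1, ..., i_n) and foldr partial_deriv bs f is the corresponding iterated
   partial derivative. *)
definition tensor_contract :: "nat \<Rightarrow> ('a::euclidean_space \<Rightarrow> real) \<Rightarrow> 'a \<Rightarrow> 'a \<Rightarrow> real" where
  "tensor_contract n f z w =
     (\<Sum>bs\<in>{bs. set bs \<subseteq> Basis \<and> length bs = n}. foldr partial_deriv bs f z * (\<Prod>b\<leftarrow>bs. w \<bullet> b))"

definition off_diag_integral ::
    "'a::euclidean_space measure \<Rightarrow> 'a measure \<Rightarrow> ('a \<Rightarrow> 'a \<Rightarrow> real) \<Rightarrow> real" where
  "off_diag_integral \<nu> \<nu>' k = (LINT p:{p. fst p \<noteq> snd p}|(\<nu> \<Otimes>\<^sub>M \<nu>'). k (fst p) (snd p))"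

(* Off-diagonal integral against the square of the signed measure \<nu> - \<mu>, expanded bilinearly. *)
definition off_diag_integral_diff ::
    "'a::euclidean_space measure \<Rightarrow> 'a measure \<Rightarrow> ('a \<Rightarrow> 'a \<Rightarrow> real) \<Rightarrow> real" where
  "off_diag_integral_diff \<nu> \<mu> k =
     off_diag_integral \<nu> \<nu> k - off_diag_integral \<nu> \<mu> k
     - off_diag_integral \<mu> \<nu> k + off_diag_integral \<mu> \<mu> k"

definition A_comm ::
    "real \<Rightarrow> nat \<Rightarrow> ('a::euclidean_space \<Rightarrow> 'a) \<Rightarrow> nat \<Rightarrow> (nat \<Rightarrow> 'a) \<Rightarrow> 'a measure \<Rightarrow> real" where
  "A_comm s n v N X \<mu> =
     off_diag_integral_diff (empirical N X) \<mu> (\<lambda>x y. tensor_contract n (riesz s) (x - y) (v x - v y))"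

(* Expectation of a function with values in [-oo, oo], as the integral of the positive part minus
   that of the negative part. Since oo - oo = oo in ereal, the value is +oo when both are infinite;
   a finite value means that the function is integrable. *)
definition expect_ereal :: "'b measure \<Rightarrow> ('b \<Rightarrow> ereal) \<Rightarrow> ereal" where
  "expect_ereal M f =
     enn2ereal (\<integral>\<^sup>+x. e2ennreal (f x) \<partial>M) - enn2ereal (\<integral>\<^sup>+x. e2ennreal (- f x) \<partial>M)"

(* Relative entropy of \<nu> with respect to \<rho>, in [0, oo]. For probability measures the negative part
   of the entropy density is always \<nu>-integrable, so non-integrability means the value +oo, whereas
   KL_divergence would return 0. *)
definition rel_entropy :: "'b measure \<Rightarrow> 'b measure \<Rightarrow> ereal" where
  "rel_entropy \<nu> \<rho> =
     (if absolutely_continuous \<rho> \<nu> \<and> integrable \<nu> (entropy_density (exp 1) \<rho> \<nu>)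
      then ereal (KL_divergence (exp 1) \<rho> \<nu>) else \<infinity>)"

definition modulated_free_energy ::
    "real \<Rightarrow> real \<Rightarrow> nat \<Rightarrow> (nat \<Rightarrow> 'a::euclidean_space) measure \<Rightarrow> 'a measure \<Rightarrow> ereal" where
  "modulated_free_energy s \<beta> N f \<mu> =
     ereal (1 / (\<beta> * real N)) * rel_entropy f (tensor_power N \<mu>) + expect_ereal f (F_energy s N \<mu>)"

definition a_scale :: "real \<Rightarrow> nat \<Rightarrow> nat \<Rightarrow> real" where
  "a_scale s d N = (if s = 0 then ln (exp 1 + real N) else real N powr (s / real d))"

end

theory Submission
  imports Defs
begin

text \<open>The Donsker--Varadhan inequality bounds the expectation of
  \<open>h = \<sigma> \<epsilon> N A - \<beta> N F\<close> under \<open>f\<close> by the relative entropy with respect to the product measure plus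
  the logarithm of its exponential moment, which is the partition function times the exponential
  moment of \<open>\<sigma> \<epsilon> N A\<close> under the Gibbs measure. Moving \<open>\<beta> N F\<close> to the other side gives the first
  bound; the second is the integrated pointwise bound together with nonnegativity of the relative
  entropy. When the entropy is finite, the same inequality for \<open>h = - \<beta> N F\<close> shows that the negative
  part of \<open>F\<close> is integrable, so that the free energy is either \<open>\<infinity>\<close> or every term in it is finite.\<close>

section \<open>Measurability of the commutator\<close>

text \<open>A class of functions containing every Riesz kernel and, away from the origin, closed under
  partial derivatives.\<close>

inductive elementary_radial :: "('a::euclidean_space \<Rightarrow> real) \<Rightarrow> bool" where
  const: "elementary_radial (\<lambda>_. c)"
| inner: "elementary_radial (\<lambda>x. x \<bullet> b)"
| powr: "elementary_radial (\<lambda>x. norm x powr a)"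
| ln: "elementary_radial (\<lambda>x. ln (norm x))"
| add: "elementary_radial f \<Longrightarrow> elementary_radial g \<Longrightarrow> elementary_radial (\<lambda>x. f x + g x)"
| mult: "elementary_radial f \<Longrightarrow> elementary_radial g \<Longrightarrow> elementary_radial (\<lambda>x. f x * g x)"

lemma elementary_radial_measurable:
  "elementary_radial f \<Longrightarrow> f \<in> borel_measurable borel"
  by (induction rule: elementary_radial.induct)
    (auto intro!: borel_measurable_times borel_measurable_add)

text \<open>The reciprocal of the norm is written as a \<open>powr\<close> so that the derivative is
  visibly a product of generators of \<open>elementary_radial\<close>.\<close>

lemma has_real_derivative_norm_line:
  fixes z b :: "'a::euclidean_space"
  assumes "z \<noteq> 0"
  shows "((\<lambda>t. norm (z + t *\<^sub>R b)) has_real_derivative (z \<bullet> b) * norm z powr (-1)) (at 0)"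
proof -
  have "((\<lambda>t. z + t *\<^sub>R b) has_derivative (\<lambda>t. t *\<^sub>R b)) (at 0)"
    by (auto intro!: derivative_eq_intros)
  moreover have "(norm has_derivative (\<lambda>h. h \<bullet> sgn z)) (at (z + 0 *\<^sub>R b))"
    using has_derivative_norm[OF assms] by simp
  ultimately have "((\<lambda>t. norm (z + t *\<^sub>R b)) has_derivative (\<lambda>t. (t *\<^sub>R b) \<bullet> sgn z)) (at 0)"
    by (rule has_derivative_compose)
  moreover have "(\<lambda>t. (t *\<^sub>R b) \<bullet> sgn z) = (*) ((z \<bullet> b) * norm z powr (-1))"
    using assms by (auto simp: fun_eq_iff sgn_div_norm powr_minus inner_commute mult_ac)
  ultimately show ?thesis
    unfolding has_field_derivative_def by simp
qed

text \<open>Induction on the generation of \<open>f\<close> by the usual rules of calculus. One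
  \<open>f'\<close> serves all points away from the origin, so it can be differentiated again. The
  origin is excluded because the norm is not differentiable there.\<close>

lemma elementary_radial_derivative:
  assumes "elementary_radial f"
  shows "\<exists>f'. elementary_radial f' \<and>
    (\<forall>z. z \<noteq> 0 \<longrightarrow> ((\<lambda>t. f (z + t *\<^sub>R b)) has_real_derivative f' z) (at 0))"
  using assms
proof (induction rule: elementary_radial.induct)
  case (const c)
  then show ?case
    by (intro exI[of _ "\<lambda>_. 0"]) (auto intro: elementary_radial.const)
next
  case (inner c)
  have "((\<lambda>t. (z + t *\<^sub>R b) \<bullet> c) has_real_derivative b \<bullet> c) (at 0)" for z
    unfolding inner_left_distrib by (auto intro!: derivative_eq_intros)
  then show ?case
    by (intro exI[of _ "\<lambda>_. b \<bullet> c"]) (auto intro: elementary_radial.const)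
next
  case (powr a)
  have "((\<lambda>t. norm (z + t *\<^sub>R b) powr a) has_real_derivative
      a * (norm z powr (a - 1) * ((z \<bullet> b) * norm z powr (-1)))) (at 0)" if "z \<noteq> 0" for z
    using DERIV_fun_powr[OF has_real_derivative_norm_line[OF that, of b], of a] that
    by (simp only: scaleR_zero_left add_0_right zero_less_norm_iff mult.assoc of_nat_1 simp_thms)
  then show ?case
    by (intro exI[of _ "\<lambda>z. a * (norm z powr (a - 1) * ((z \<bullet> b) * norm z powr (-1)))"])
      (intro conjI allI impI elementary_radial.intros, assumption)
next
  case ln
  have "((\<lambda>t. ln (norm (z + t *\<^sub>R b))) has_real_derivative
      norm z powr (-1) * ((z \<bullet> b) * norm z powr (-1))) (at 0)" if "z \<noteq> 0" for z
  proof -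
    have "(ln has_real_derivative norm z powr (-1)) (at (norm (z + 0 *\<^sub>R b)))"
      using that by (auto intro!: derivative_eq_intros simp: powr_minus inverse_eq_divide)
    from DERIV_chain2[OF this has_real_derivative_norm_line[OF that]] show ?thesis .
  qed
  then show ?case
    by (intro exI[of _ "\<lambda>z. norm z powr (-1) * ((z \<bullet> b) * norm z powr (-1))"])
      (intro conjI allI impI elementary_radial.intros, assumption)
next
  case (add f g)
  then obtain f' g' where
    "elementary_radial f'" "elementary_radial g'"
    "\<And>z. z \<noteq> 0 \<Longrightarrow> ((\<lambda>t. f (z + t *\<^sub>R b)) has_real_derivative f' z) (at 0)"
    "\<And>z. z \<noteq> 0 \<Longrightarrow> ((\<lambda>t. g (z + t *\<^sub>R b)) has_real_derivative g' z) (at 0)"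
    by blast
  then show ?case
    by (intro exI[of _ "\<lambda>z. f' z + g' z"])
      (auto intro!: elementary_radial.intros DERIV_add)
next
  case (mult f g)
  then obtain f' g' where *:
    "elementary_radial f'" "elementary_radial g'"
    "\<And>z. z \<noteq> 0 \<Longrightarrow> ((\<lambda>t. f (z + t *\<^sub>R b)) has_real_derivative f' z) (at 0)"
    "\<And>z. z \<noteq> 0 \<Longrightarrow> ((\<lambda>t. g (z + t *\<^sub>R b)) has_real_derivative g' z) (at 0)"
    by blast
  have "((\<lambda>t. f (z + t *\<^sub>R b) * g (z + t *\<^sub>R b)) has_real_derivative f' z * g z + g' z * f z) (at 0)"
    if "z \<noteq> 0" for z
    using DERIV_mult[OF *(3,4)[OF that]] by simp
  then show ?case
    using * mult.hyps
    by (intro exI[of _ "\<lambda>z. f' z * g z + g' z * f z"]) (auto intro!: elementary_radial.intros)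
qed

text \<open>This is the induction step for iterated partial derivatives, whose values at the origin
  are uncontrolled; hence \<open>f\<close> and \<open>g\<close> are compared only elsewhere. The
  complement of the origin is open, so both functions agree along a short segment through
  \<open>z\<close> and have the same derivative there.\<close>

lemma partial_deriv_elementary_radial:
  assumes "elementary_radial g" and "\<And>z. z \<noteq> 0 \<Longrightarrow> f z = g z"
  shows "\<exists>g'. elementary_radial g' \<and> (\<forall>z. z \<noteq> 0 \<longrightarrow> partial_deriv b f z = g' z)"
proof -
  obtain g' where g': "elementary_radial g'"
    "\<And>z. z \<noteq> 0 \<Longrightarrow> ((\<lambda>t. g (z + t *\<^sub>R b)) has_real_derivative g' z) (at 0)"
    using elementary_radial_derivative[OF assms(1)] by blast
  have "partial_deriv b f z = g' z" if "z \<noteq> 0" for z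
  proof -
    have "((\<lambda>t::real. z + t *\<^sub>R b) \<longlongrightarrow> z + 0 *\<^sub>R b) (nhds 0)"
      by (intro tendsto_intros filterlim_ident)
    then have "\<forall>\<^sub>F t in nhds 0. z + t *\<^sub>R b \<noteq> 0"
      using that by (intro tendsto_imp_eventually_ne) auto
    then have "\<forall>\<^sub>F t in nhds 0. f (z + t *\<^sub>R b) = g (z + t *\<^sub>R b)"
      by eventually_elim (simp add: assms(2))
    then have "((\<lambda>t. f (z + t *\<^sub>R b)) has_real_derivative g' z) (at 0)
        \<longleftrightarrow> ((\<lambda>t. g (z + t *\<^sub>R b)) has_real_derivative g' z) (at 0)"
      by (intro DERIV_cong_ev refl)
    then have "((\<lambda>t. f (z + t *\<^sub>R b)) has_real_derivative g' z) (at 0)"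
      using g'(2)[OF that] by simp
    then show ?thesis
      unfolding partial_deriv_def by (rule DERIV_imp_deriv)
  qed
  with g'(1) show ?thesis by blast
qed

lemma riesz_elementary_radial: "elementary_radial (riesz s)"
proof (cases "s = 0")
  case True
  then have "riesz s = (\<lambda>x::'a. -1 * ln (norm x))"
    by (simp add: riesz_def fun_eq_iff)
  moreover have "elementary_radial (\<lambda>x::'a. -1 * ln (norm x))"
    by (intro elementary_radial.intros)
  ultimately show ?thesis by simp
next
  case False
  then have "riesz s = (\<lambda>x::'a. (1 / s) * norm x powr (- s))"
    by (simp add: riesz_def fun_eq_iff)
  moreover have "elementary_radial (\<lambda>x::'a. (1 / s) * norm x powr (- s))"
    by (intro elementary_radial.intros)
  ultimately show ?thesis by simp
qed

lemma riesz_measurable [measurable]: "riesz s \<in> borel_measurable borel"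
  by (rule elementary_radial_measurable[OF riesz_elementary_radial])

text \<open>Away from the origin the iterated derivative is an elementary function. Whatever value
  \<open>deriv\<close> yields at the origin changes a Borel function at a single point only.\<close>

lemma iterated_partial_deriv_riesz_measurable [measurable]:
  "foldr partial_deriv bs (riesz s) \<in> borel_measurable borel"
proof -
  let ?f = "foldr partial_deriv bs (riesz s) :: 'a \<Rightarrow> real"
  have "\<exists>g. elementary_radial g \<and> (\<forall>z. z \<noteq> 0 \<longrightarrow> ?f z = g z)"
  proof (induction bs)
    case Nil
    then show ?case using riesz_elementary_radial by auto
  next
    case (Cons b bs)
    then obtain g where g: "elementary_radial g"
      "\<And>z. z \<noteq> 0 \<Longrightarrow> foldr partial_deriv bs (riesz s) z = g z"
      by blast
    from partial_deriv_elementary_radial[OF g] show ?case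
      by simp
  qed
  then obtain g where g: "elementary_radial g" "\<And>z. z \<noteq> 0 \<Longrightarrow> ?f z = g z"
    by blast
  have [measurable]: "g \<in> borel_measurable borel"
    by (rule elementary_radial_measurable[OF g(1)])
  have "?f = (\<lambda>z. if z = 0 then ?f 0 else g z)"
    using g(2) by auto
  also have "\<dots> \<in> borel_measurable borel"
    by measurable
  finally show ?thesis .
qed

text \<open>The measures of integration move with the parameter \<open>X\<close>, but each is the
  image of a fixed probability space under a map depending on \<open>X\<close>. A change of
  variables moves this dependence into the integrand, leaving a parametrised integral against the
  fixed product of \<open>P\<close> and \<open>P'\<close>.\<close>

lemma integral_pair_distr_measurable:
  fixes h :: "'b::{second_countable_topology, topological_space} \<times> 'b \<Rightarrow> real"
  assumes P: "prob_space P" and P': "prob_space P'"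
    and Y[measurable]: "case_prod Y \<in> borel_measurable (M \<Otimes>\<^sub>M P)"
    and Y'[measurable]: "case_prod Y' \<in> borel_measurable (M \<Otimes>\<^sub>M P')"
    and h: "h \<in> borel_measurable (borel \<Otimes>\<^sub>M borel)"
  shows "(\<lambda>X. \<integral>p. h p \<partial>(distr P borel (Y X) \<Otimes>\<^sub>M distr P' borel (Y' X))) \<in> borel_measurable M"
proof -
  interpret P: prob_space P by fact
  interpret P': prob_space P' by fact
  interpret PP: pair_prob_space P P' ..
  note h[measurable]
  have "(\<integral>p. h p \<partial>(distr P borel (Y X) \<Otimes>\<^sub>M distr P' borel (Y' X)))
      = (\<integral>w. h (Y X (fst w), Y' X (snd w)) \<partial>(P \<Otimes>\<^sub>M P'))" if X: "X \<in> space M" for X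
  proof -
    have [measurable]: "Y X \<in> borel_measurable P" "Y' X \<in> borel_measurable P'"
      using measurable_Pair2[OF Y X] measurable_Pair2[OF Y' X] by simp_all
    interpret D: prob_space "distr P' borel (Y' X)"
      by (rule P'.prob_space_distr) measurable
    show ?thesis
      by (subst pair_measure_distr)
        (auto simp: integral_distr case_prod_beta' D.sigma_finite_measure_axioms)
  qed
  moreover have "(\<lambda>X. \<integral>w. h (Y X (fst w), Y' X (snd w)) \<partial>(P \<Otimes>\<^sub>M P')) \<in> borel_measurable M"
  proof (rule PP.borel_measurable_lebesgue_integral)
    have "(\<lambda>q. (fst q, fst (snd q))) \<in> M \<Otimes>\<^sub>M (P \<Otimes>\<^sub>M P') \<rightarrow>\<^sub>M M \<Otimes>\<^sub>M P"
        "(\<lambda>q. (fst q, snd (snd q))) \<in> M \<Otimes>\<^sub>M (P \<Otimes>\<^sub>M P') \<rightarrow>\<^sub>M M \<Otimes>\<^sub>M P'"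
      by measurable
    from measurable_compose[OF this(1) Y] measurable_compose[OF this(2) Y']
    have "(\<lambda>q. (Y (fst q) (fst (snd q)), Y' (fst q) (snd (snd q))))
        \<in> M \<Otimes>\<^sub>M (P \<Otimes>\<^sub>M P') \<rightarrow>\<^sub>M borel \<Otimes>\<^sub>M borel"
      by (intro measurable_Pair) simp_all
    from measurable_compose[OF this h]
    show "(\<lambda>(X, w). h (Y X (fst w), Y' X (snd w))) \<in> borel_measurable (M \<Otimes>\<^sub>M (P \<Otimes>\<^sub>M P'))"
      by (simp add: case_prod_beta')
  qed
  ultimately show ?thesis
    by (simp cong: measurable_cong)
qed

lemma tensor_contract_riesz_measurable:
  fixes v :: "'a::euclidean_space \<Rightarrow> 'a"
  assumes [measurable]: "v \<in> borel_measurable borel"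
  shows "(\<lambda>p. tensor_contract n (riesz s) (fst p - snd p) (v (fst p) - v (snd p)))
    \<in> borel_measurable (borel \<Otimes>\<^sub>M borel)"
proof -
  have [measurable]: "(\<lambda>w. \<Prod>b\<leftarrow>bs. w \<bullet> b) \<in> borel_measurable borel" for bs :: "'a list"
    by (induction bs) (auto intro!: borel_measurable_times)
  show ?thesis
    unfolding tensor_contract_def by (intro borel_measurable_sum) measurable
qed

text \<open>With the indicator of the off-diagonal set absorbed into the integrand \<open>h\<close>,
  each of the four terms of the bilinear expansion is either constant in \<open>X\<close> or an
  integral against moving image measures. The empirical measure is the image of the uniform measure
  on the indices under the configuration itself.\<close>

lemma A_comm_measurable:
  fixes \<mu> :: "'a::euclidean_space measure"
  assumes N: "N \<ge> 1" and \<mu>: "prob_space \<mu>" "sets \<mu> = sets borel"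
    and v: "v \<in> borel_measurable borel"
  shows "(\<lambda>X. A_comm s n v N X \<mu>) \<in> borel_measurable (config_space N)"
proof -
  let ?U = "uniform_count_measure {..<N}"
  let ?C = "config_space N :: (nat \<Rightarrow> 'a) measure"
  define k where "k = (\<lambda>x y. tensor_contract n (riesz s) (x - y) (v x - v y))"
  define h where "h = (\<lambda>p::'a \<times> 'a. indicator {p. fst p \<noteq> snd p} p *\<^sub>R k (fst p) (snd p))"
  have "{p \<in> space (borel \<Otimes>\<^sub>M borel). fst p \<noteq> (snd p :: 'a)} \<in> sets (borel \<Otimes>\<^sub>M borel)"
    by measurable
  then have "{p. fst p \<noteq> (snd p :: 'a)} \<in> sets (borel \<Otimes>\<^sub>M borel)"
    by (simp add: space_pair_measure)
  then have h: "h \<in> borel_measurable (borel \<Otimes>\<^sub>M borel)"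
    unfolding h_def k_def
    by (intro borel_measurable_scaleR borel_measurable_indicator
        tensor_contract_riesz_measurable[OF v])
  have U: "prob_space ?U"
    using N by (intro prob_space_uniform_count_measure) (auto simp: lessThan_empty_iff)
  \<comment> \<open>Joint measurability of evaluation reduces to measurability of each coordinate,
    because the index set is finite.\<close>
  have evaluation: "(\<lambda>(X, i). X i) \<in> borel_measurable (?C \<Otimes>\<^sub>M ?U)"
  proof -
    have "(\<lambda>q. (\<lambda>i q. fst q i) (snd q) q) \<in> borel_measurable (?C \<Otimes>\<^sub>M ?U)"
    proof (rule measurable_compose_countable'[where I = "{..<N}" and g = snd])
      show "snd \<in> ?C \<Otimes>\<^sub>M ?U \<rightarrow>\<^sub>M count_space {..<N}"
        using measurable_snd[of ?C ?U]
        unfolding measurable_cong_sets[OF refl sets_uniform_count_measure_count_space] .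
    qed (auto intro!: measurable_compose[OF measurable_fst] measurable_component_singleton)
    then show ?thesis by (simp add: case_prod_beta')
  qed
  have projection: "(\<lambda>(X, y). y) \<in> borel_measurable (?C \<Otimes>\<^sub>M \<mu>)"
    using measurable_snd[of ?C \<mu>] \<mu>(2) by (simp add: case_prod_beta' cong: measurable_cong_sets)
  \<comment> \<open>Viewing \<open>\<mu>\<close> as its own image under the identity gives the mixed
    terms the form required by \<open>integral_pair_distr_measurable\<close>.\<close>
  have \<mu>_distr: "distr \<mu> borel (\<lambda>y. y) = \<mu>"
    by (rule distr_id2) (simp add: \<mu>(2))
  have A: "A_comm s n v N X \<mu> =
      (\<integral>p. h p \<partial>(distr ?U borel X \<Otimes>\<^sub>M distr ?U borel X))
      - (\<integral>p. h p \<partial>(distr ?U borel X \<Otimes>\<^sub>M distr \<mu> borel (\<lambda>y. y)))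
      - (\<integral>p. h p \<partial>(distr \<mu> borel (\<lambda>y. y) \<Otimes>\<^sub>M distr ?U borel X))
      + (\<integral>p. h p \<partial>(\<mu> \<Otimes>\<^sub>M \<mu>))" for X
    unfolding A_comm_def off_diag_integral_diff_def off_diag_integral_def set_lebesgue_integral_def
      empirical_def h_def k_def \<mu>_distr ..
  show ?thesis
    unfolding A
    by (intro borel_measurable_add borel_measurable_diff borel_measurable_const
        integral_pair_distr_measurable[OF U U evaluation evaluation h]
        integral_pair_distr_measurable[OF U \<mu>(1) evaluation projection h]
        integral_pair_distr_measurable[OF \<mu>(1) U projection evaluation h])
qed

section \<open>The variational principle\<close>

text \<open>The inequality \<open>1 + t \<le> exp t\<close> at \<open>t = h x - l x - ln Z\<close>
  gives \<open>h \<le> l + ln Z + w - 1\<close> pointwise, and \<open>w\<close> has integral at most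
  1 under \<open>N\<close> by change of measure. The right side is integrable, so it controls the
  positive part of \<open>h\<close> even before \<open>h\<close> is known to be integrable;
  integrating it gives the second claim.\<close>

lemma (in prob_space) donsker_varadhan:
  assumes N: "prob_space N" "sets N = sets M" "absolutely_continuous M N"
    and L: "integrable N (entropy_density (exp 1) M N)"
    and h[measurable]: "h \<in> borel_measurable M"
    and Z: "Z > 0" "(\<integral>\<^sup>+x. ennreal (exp (h x)) \<partial>M) \<le> ennreal Z"
  shows "(\<integral>\<^sup>+x. ennreal (h x) \<partial>N) < \<infinity>"
    and "integrable N h \<Longrightarrow> (\<integral>x. h x \<partial>N) \<le> KL_divergence (exp 1) M N + ln Z"
proof -
  interpret N: prob_space N by fact
  note N(2)[measurable_cong]
  define l where "l = entropy_density (exp 1) M N"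
  define w where "w = (\<lambda>x. exp (h x - l x - ln Z))"
  have [measurable]: "l \<in> borel_measurable M"
    unfolding l_def by measurable
  have [measurable]: "w \<in> borel_measurable M"
    unfolding w_def by measurable
  have "(\<integral>\<^sup>+x. ennreal (w x) \<partial>N) = (\<integral>\<^sup>+x. RN_deriv M N x * ennreal (w x) \<partial>M)"
    by (rule RN_deriv_nn_integral[OF N(3,2)]) measurable
  also have "\<dots> \<le> (\<integral>\<^sup>+x. ennreal (1 / Z) * ennreal (exp (h x)) \<partial>M)"
  proof (rule nn_integral_mono_AE)
    \<comment> \<open>Where the density is positive it cancels the factor \<open>exp (- l x)\<close>
      and equality holds. Where it vanishes the left side is 0, which is why only an inequality is
      claimed.\<close>
    have "RN_deriv M N x * ennreal (w x) \<le> ennreal (1 / Z) * ennreal (exp (h x))"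
      if fin: "RN_deriv M N x \<noteq> \<infinity>" for x
    proof (cases "RN_deriv M N x = 0")
      case False
      define d where "d = enn2real (RN_deriv M N x)"
      have d: "RN_deriv M N x = ennreal d" "d > 0"
        using fin False unfolding d_def
        by (auto simp: ennreal_enn2real_if less_top enn2real_positive_iff zero_less_iff_neq_zero)
      have "l x = ln d"
        unfolding l_def entropy_density_def d_def by (simp add: log_def)
      then have "d * w x = 1 / Z * exp (h x)"
        using d(2) Z(1) by (simp add: w_def exp_diff)
      with d Z(1) show ?thesis
        by (simp add: ennreal_mult[symmetric] w_def)
    qed simp
    then show "AE x in M. RN_deriv M N x * ennreal (w x) \<le> ennreal (1 / Z) * ennreal (exp (h x))"
      using RN_deriv_finite[OF N.sigma_finite_measure_axioms N(3,2)] by auto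
  qed
  also have "\<dots> \<le> ennreal (1 / Z) * ennreal Z"
    using Z(2) by (subst nn_integral_cmult) (auto intro: mult_left_mono)
  also have "\<dots> = 1"
    using Z(1) by (simp add: ennreal_mult[symmetric])
  finally have w_le: "(\<integral>\<^sup>+x. ennreal (w x) \<partial>N) \<le> 1" .
  then have w: "integrable N w"
    by (intro integrableI_nonneg) (auto simp: w_def intro: le_less_trans)
  have "ennreal (\<integral>x. w x \<partial>N) = (\<integral>\<^sup>+x. ennreal (w x) \<partial>N)"
    by (rule nn_integral_eq_integral[OF w, symmetric]) (simp add: w_def)
  with w_le have w_le': "(\<integral>x. w x \<partial>N) \<le> 1"
    by (metis ennreal_le_1)
  have h_le: "h x \<le> l x + ln Z + w x - 1" for x
    unfolding w_def using exp_ge_add_one_self[of "h x - l x - ln Z"] by linarith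
  have l: "integrable N l"
    using L unfolding l_def .
  have bound: "integrable N (\<lambda>x. l x + ln Z + w x - 1)"
    using l w by simp
  have "(\<integral>\<^sup>+x. ennreal (h x) \<partial>N) \<le> (\<integral>\<^sup>+x. ennreal (norm (l x + ln Z + w x - 1)) \<partial>N)"
    using h_le by (intro nn_integral_mono ennreal_leI) (smt (verit) real_norm_def)
  also have "\<dots> < \<infinity>"
    using bound by (simp add: integrable_iff_bounded)
  finally show "(\<integral>\<^sup>+x. ennreal (h x) \<partial>N) < \<infinity>" .
  assume "integrable N h"
  then have "(\<integral>x. h x \<partial>N) \<le> (\<integral>x. l x + ln Z + w x - 1 \<partial>N)"
    using bound h_le by (intro integral_mono) auto
  also have "\<dots> = (\<integral>x. l x \<partial>N) + ln Z + (\<integral>x. w x \<partial>N) - 1"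
    using l w by (simp add: N.prob_space)
  finally show "(\<integral>x. h x \<partial>N) \<le> KL_divergence (exp 1) M N + ln Z"
    using w_le' by (simp add: KL_divergence_def l_def)
qed

section \<open>Expectations with values in the extended reals\<close>

lemma expect_ereal_cong_AE:
  assumes "AE x in M. f x = g x"
  shows "expect_ereal M f = expect_ereal M g"
  unfolding expect_ereal_def
  by (intro arg_cong2[of _ _ _ _ minus] arg_cong[of _ _ enn2ereal] nn_integral_cong_AE)
    (use assms in auto)

lemma expect_ereal_integrable:
  assumes "integrable M g"
  shows "expect_ereal M (\<lambda>x. ereal (g x)) = ereal (\<integral>x. g x \<partial>M)"
proof -
  have "(\<integral>\<^sup>+x. ennreal (g x) \<partial>M) \<noteq> \<infinity>" "(\<integral>\<^sup>+x. ennreal (- g x) \<partial>M) \<noteq> \<infinity>"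
    using assms by (simp_all add: real_integrable_def)
  then show ?thesis
    using assms
    by (cases "\<integral>\<^sup>+x. ennreal (g x) \<partial>M"; cases "\<integral>\<^sup>+x. ennreal (- g x) \<partial>M")
      (auto simp: expect_ereal_def e2ennreal_ereal real_lebesgue_integral_def)
qed

text \<open>With a finite negative part, integrability can fail only through the positive
  part.\<close>

lemma expect_ereal_eq_PInf:
  assumes "g \<in> borel_measurable M" and "(\<integral>\<^sup>+x. ennreal (- g x) \<partial>M) < \<infinity>" and "\<not> integrable M g"
  shows "expect_ereal M (\<lambda>x. ereal (g x)) = \<infinity>"
proof -
  have "(\<integral>\<^sup>+x. ennreal (g x) \<partial>M) = \<infinity>"
    using assms by (auto simp: real_integrable_def)
  then show ?thesis
    by (simp add: expect_ereal_def e2ennreal_ereal)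
qed

text \<open>The abstract form of the argument, for an arbitrary reference measure
  \<open>\<rho>\<close>, energy \<open>F\<close> and observable \<open>A\<close>, with
  \<open>k\<close> in the role of the number of particles. \<open>Z'\<close> bounds the partition
  function, and \<open>Z\<close> bounds the exponential moments of both signs against the
  unnormalised Gibbs weight.\<close>

lemma expectation_le_free_energy:
  fixes F :: "'b \<Rightarrow> ereal" and A :: "'b \<Rightarrow> real"
  assumes \<rho>: "prob_space \<rho>" and f: "prob_space f" "sets f = sets \<rho>"
    and F[measurable]: "F \<in> borel_measurable \<rho>" and F_fin: "AE x in \<rho>. \<bar>F x\<bar> \<noteq> \<infinity>"
    and A[measurable]: "A \<in> borel_measurable \<rho>"
    and pos: "\<beta> > 0" "k > 0" "\<epsilon> > 0" "Z > 0" "Z' > 0" "C \<ge> 0"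
    and pointwise: "\<And>x. x \<in> space \<rho> \<Longrightarrow> ereal \<bar>A x\<bar> \<le> ereal C * (F x + ereal c)"
    and partition: "(\<integral>\<^sup>+x. ennreal (exp (- (\<beta> * k * real_of_ereal (F x)))) \<partial>\<rho>) \<le> ennreal Z'"
    and moment: "\<And>\<sigma>. \<sigma> \<in> {1, -1} \<Longrightarrow>
      (\<integral>\<^sup>+x. ennreal (exp (\<sigma> * \<epsilon> * k * A x - \<beta> * k * real_of_ereal (F x))) \<partial>\<rho>) \<le> ennreal Z"
  defines "E \<equiv> ereal (1 / (\<beta> * k)) * rel_entropy f \<rho> + expect_ereal f F"
  shows "\<bar>expect_ereal f (\<lambda>x. ereal (k * A x))\<bar>
      \<le> min (ereal (\<beta> / \<epsilon>) * (ereal k * E) + ereal (1 / \<epsilon> * ln Z))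
            (ereal C * (ereal k * E) + ereal (C * (k * c)))"
proof -
  interpret \<rho>: prob_space \<rho> by fact
  interpret f: prob_space f by fact
  note f(2)[measurable_cong]
  define G where "G = (\<lambda>x. real_of_ereal (F x))"
  have [measurable]: "G \<in> borel_measurable \<rho>"
    unfolding G_def by measurable
  let ?H = "KL_divergence (exp 1) \<rho> f"
  \<comment> \<open>Both bounds are infinite unless \<open>C = 0\<close>. In that case the second
    bound is 0, since 0 times infinity is 0 in \<open>ereal\<close>, but the pointwise estimate then
    forces \<open>A\<close> to vanish.\<close>
  have infinite_case: ?thesis if "E = \<infinity>"
  proof (cases "C = 0")
    case True
    then have "A x = 0" if "x \<in> space f" for x
      using pointwise[of x] that sets_eq_imp_space_eq[OF f(2)] by (simp flip: zero_ereal_def)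
    then have "expect_ereal f (\<lambda>x. ereal (k * A x)) = expect_ereal f (\<lambda>x. ereal 0)"
      by (intro expect_ereal_cong_AE AE_I2) simp
    also have "\<dots> = 0"
      using expect_ereal_integrable[of f "\<lambda>_. 0"] by (simp add: zero_ereal_def)
    finally show ?thesis
      using that pos True by (simp add: zero_ereal_def)
  qed (use that pos in simp)
  show ?thesis
  proof (cases "absolutely_continuous \<rho> f \<and> integrable f (entropy_density (exp 1) \<rho> f)")
    case False
    then have "rel_entropy f \<rho> = \<infinity>"
      by (simp add: rel_entropy_def)
    \<comment> \<open>In \<open>ereal\<close> the sum of plus and minus infinity is plus infinity,
      so an infinite entropy decides the value of \<open>E\<close> whatever the expectation of
      \<open>F\<close> is.\<close>
    then have "E = \<infinity>"
      using pos by (simp add: E_def)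
    then show ?thesis by (rule infinite_case)
  next
    case True
    then have ac: "absolutely_continuous \<rho> f" "integrable f (entropy_density (exp 1) \<rho> f)"
      by auto
    note dv = \<rho>.donsker_varadhan[OF f ac]
    have H: "rel_entropy f \<rho> = ereal ?H"
      using ac by (simp add: rel_entropy_def)
    \<comment> \<open>Finiteness of the energy passes from \<open>\<rho>\<close> to \<open>f\<close>
      by absolute continuity, so the real-valued \<open>G\<close> can replace \<open>F\<close> from
      here on.\<close>
    have F_eq: "AE x in f. F x = ereal (G x)"
      using absolutely_continuous_AE[OF f(2) ac(1) F_fin] by eventually_elim (simp add: G_def ereal_real)
    have "(\<integral>\<^sup>+x. ennreal (- (\<beta> * k * G x)) \<partial>f) < \<infinity>"
      using partition pos by (intro dv(1)[of _ Z']) (simp_all add: G_def)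
    moreover have "(\<integral>\<^sup>+x. ennreal (- (\<beta> * k * G x)) \<partial>f)
        = ennreal (\<beta> * k) * (\<integral>\<^sup>+x. ennreal (- G x) \<partial>f)"
      using pos by (subst nn_integral_cmult[symmetric]) (auto simp: ennreal_mult'[symmetric])
    ultimately have G_neg: "(\<integral>\<^sup>+x. ennreal (- G x) \<partial>f) < \<infinity>"
      using pos by (auto simp: ennreal_mult_less_top less_top)
    show ?thesis
    proof (cases "integrable f G")
      case False
      then have "expect_ereal f F = \<infinity>"
        using expect_ereal_cong_AE[OF F_eq] expect_ereal_eq_PInf[OF _ G_neg] by simp
      then have "E = \<infinity>"
        by (simp add: E_def)
      then show ?thesis by (rule infinite_case)
    next
      case G: True
      then have E: "E = ereal (1 / (\<beta> * k) * ?H + (\<integral>x. G x \<partial>f))"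
        using expect_ereal_cong_AE[OF F_eq] by (simp add: E_def H expect_ereal_integrable)
      have A_le: "AE x in f. \<bar>A x\<bar> \<le> C * (G x + c)"
        using F_eq AE_space
        by eventually_elim (use pointwise sets_eq_imp_space_eq[OF f(2)] in force)
      have A_int: "integrable f A"
      proof (rule Bochner_Integration.integrable_bound)
        show "integrable f (\<lambda>x. C * (G x + c))"
          using G by simp
        show "AE x in f. norm (A x) \<le> norm (C * (G x + c))"
          using A_le by eventually_elim auto
      qed measurable
      \<comment> \<open>The two signs give the two sides of the absolute value. The factor
        \<open>\<beta> * k\<close> from the exponent cancels the weight
        \<open>1 / (\<beta> * k)\<close> of the entropy in \<open>E\<close>.\<close>
      have first: "\<sigma> * (k * (\<integral>x. A x \<partial>f)) \<le> \<beta> / \<epsilon> * (k * (1 / (\<beta> * k) * ?H + (\<integral>x. G x \<partial>f))) + 1 / \<epsilon> * ln Z"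
        if "\<sigma> \<in> {1, -1}" for \<sigma>
      proof -
        have "(\<integral>x. \<sigma> * \<epsilon> * k * A x - \<beta> * k * G x \<partial>f) \<le> ?H + ln Z"
          using moment[OF that] A_int G pos by (intro dv(2)) (simp_all add: G_def)
        then have "\<sigma> * \<epsilon> * k * (\<integral>x. A x \<partial>f) - \<beta> * k * (\<integral>x. G x \<partial>f) \<le> ?H + ln Z"
          using A_int G by simp
        then have "\<epsilon> * (\<sigma> * (k * (\<integral>x. A x \<partial>f))) \<le> ?H + \<beta> * k * (\<integral>x. G x \<partial>f) + ln Z"
          by (simp add: algebra_simps)
        then have "\<sigma> * (k * (\<integral>x. A x \<partial>f)) \<le> (?H + \<beta> * k * (\<integral>x. G x \<partial>f) + ln Z) / \<epsilon>"
          using pos by (simp add: pos_le_divide_eq mult.commute)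
        also have "\<dots> = \<beta> / \<epsilon> * (k * (1 / (\<beta> * k) * ?H + (\<integral>x. G x \<partial>f))) + 1 / \<epsilon> * ln Z"
          using pos by (simp add: field_simps)
        finally show ?thesis .
      qed
      \<comment> \<open>The variational inequality for the zero function with \<open>Z = 1\<close>
        is nonnegativity of the relative entropy; below it allows the energy to be enlarged to the
        free energy.\<close>
      have "(\<integral>x. 0 \<partial>f) \<le> ?H + ln 1"
        by (intro dv(2)) (simp_all add: \<rho>.emeasure_space_1)
      then have "0 \<le> ?H"
        by simp
      have "\<bar>\<integral>x. A x \<partial>f\<bar> \<le> (\<integral>x. \<bar>A x\<bar> \<partial>f)"
        by (rule integral_abs_bound)
      also have "\<dots> \<le> (\<integral>x. C * (G x + c) \<partial>f)"
        using A_int G A_le by (intro integral_mono_AE) auto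
      also have "\<dots> = C * ((\<integral>x. G x \<partial>f) + c)"
        using G by (simp add: f.prob_space)
      also have "\<dots> \<le> C * (1 / (\<beta> * k) * ?H + (\<integral>x. G x \<partial>f) + c)"
        using pos \<open>0 \<le> ?H\<close> by (intro mult_left_mono) auto
      finally have "k * \<bar>\<integral>x. A x \<partial>f\<bar> \<le> k * (C * (1 / (\<beta> * k) * ?H + (\<integral>x. G x \<partial>f) + c))"
        using pos by (intro mult_left_mono) auto
      then have second: "\<bar>k * (\<integral>x. A x \<partial>f)\<bar>
          \<le> C * (k * (1 / (\<beta> * k) * ?H + (\<integral>x. G x \<partial>f))) + C * (k * c)"
        using pos by (simp add: abs_mult algebra_simps)
      have "expect_ereal f (\<lambda>x. ereal (k * A x)) = ereal (k * (\<integral>x. A x \<partial>f))"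
        using expect_ereal_integrable[of f "\<lambda>x. k * A x"] A_int by simp
      then show ?thesis
        using first[of 1] first[of "-1"] second unfolding E by (simp add: abs_le_iff)
    qed
  qed
qed

section \<open>The modulated energy and the Gibbs measure\<close>

lemma emeasure_singleton_bounded_density:
  assumes "bounded_density \<mu>"
  shows "emeasure \<mu> {x} = 0"
proof -
  obtain \<rho> where "\<rho> \<in> borel_measurable lborel" "\<mu> = density lborel \<rho>"
    using assms by (auto simp: bounded_density_def)
  then have "absolutely_continuous lborel \<mu>"
    by (simp add: absolutely_continuousI_density)
  then have "null_sets lborel \<subseteq> null_sets \<mu>"
    by (simp add: absolutely_continuous_def)
  moreover have "{x} \<in> null_sets lborel"
    by (simp add: null_sets_def)
  ultimately show ?thesis by auto
qed

text \<open>For a fixed pair of indices, integrate first over coordinate \<open>i\<close>: with the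
  others frozen it must hit the single point \<open>X j\<close>, which has measure zero. There are
  finitely many pairs. This makes the energy finite almost everywhere under the product
  measure.\<close>

lemma AE_tensor_power_distinct:
  fixes \<mu> :: "'a::euclidean_space measure"
  assumes \<mu>: "prob_space \<mu>" "sets \<mu> = sets borel" and null: "\<And>x. emeasure \<mu> {x} = 0"
  shows "AE X in tensor_power N \<mu>. inj_on X {..<N}"
proof -
  interpret \<mu>: prob_space \<mu> by fact
  interpret product_sigma_finite "\<lambda>_. \<mu>"
    by (simp add: product_sigma_finite_def \<mu>.sigma_finite_measure_axioms)
  note \<mu>(2)[measurable_cong]
  have "AE X in tensor_power N \<mu>. X i \<noteq> X j" if ij: "i < N" "j < N" "i \<noteq> j" for i j
  proof -
    \<comment> \<open>This puts the index set in the form in which Fubini splits off the coordinate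
      \<open>i\<close>.\<close>
    have I: "insert i ({..<N} - {i}) = {..<N}"
      using ij by auto
    have [measurable]: "(\<lambda>X. X i) \<in> borel_measurable (tensor_power N \<mu>)"
        "(\<lambda>X. X j) \<in> borel_measurable (tensor_power N \<mu>)"
      using ij \<mu>(2) measurable_component_singleton[of _ "{..<N}" "\<lambda>_. \<mu>"]
      by (simp_all cong: measurable_cong_sets)
    have "(\<lambda>X. indicator {0} (X i - X j) :: ennreal) \<in> borel_measurable (tensor_power N \<mu>)"
      by measurable
    then have "(\<integral>\<^sup>+X. indicator {0} (X i - X j) \<partial>tensor_power N \<mu>)
        = (\<integral>\<^sup>+X. (\<integral>\<^sup>+y. indicator {0} ((X(i := y)) i - (X(i := y)) j) \<partial>\<mu>) \<partial>(\<Pi>\<^sub>M i\<in>{..<N} - {i}. \<mu>))"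
      using product_nn_integral_insert[of "{..<N} - {i}" i "\<lambda>X. indicator {0} (X i - X j)"]
      by (simp only: I) simp
    also have "\<dots> = (\<integral>\<^sup>+X. (\<integral>\<^sup>+y. indicator {X j} y \<partial>\<mu>) \<partial>(\<Pi>\<^sub>M i\<in>{..<N} - {i}. \<mu>))"
      using ij by (intro nn_integral_cong) (auto simp: indicator_def)
    also have "\<dots> = 0"
      using \<mu>(2) null by simp
    finally have "AE X in tensor_power N \<mu>. indicator {0} (X i - X j) = (0::ennreal)"
      by (subst (asm) nn_integral_0_iff_AE) measurable
    then show ?thesis
      by eventually_elim (auto simp: indicator_def split: if_splits)
  qed
  then have "AE X in tensor_power N \<mu>. \<forall>i\<in>{..<N}. \<forall>j\<in>{..<N}. i \<noteq> j \<longrightarrow> X i \<noteq> X j"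
    by (auto simp: AE_finite_all)
  then show ?thesis
    by eventually_elim (auto simp: inj_on_def)
qed

lemma potential_measurable:
  fixes \<mu> :: "'a::euclidean_space measure"
  assumes "prob_space \<mu>" and "sets \<mu> = sets borel"
  shows "potential s \<mu> \<in> borel_measurable borel"
proof -
  interpret prob_space \<mu> by fact
  note assms(2)[measurable_cong]
  have "(\<lambda>x. \<integral>y. riesz s (x - y) \<partial>\<mu>) \<in> borel_measurable borel"
    by measurable
  then show ?thesis
    by (simp add: potential_def[abs_def])
qed

lemma F_energy_measurable:
  fixes \<mu> :: "'a::euclidean_space measure"
  assumes "prob_space \<mu>" and "sets \<mu> = sets borel"
  shows "F_energy s N \<mu> \<in> borel_measurable (config_space N)"
proof -
  note potential_measurable[OF assms, measurable]
  show ?thesis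
    unfolding F_energy_def[abs_def] g_tilde_def riesz_ext_def
    by (intro borel_measurable_ereal_add borel_measurable_ereal_diff borel_measurable_ereal_times
        borel_measurable_ereal_sum borel_measurable_ereal borel_measurable_const) measurable
qed

lemma F_energy_finite:
  assumes "inj_on X {..<N}"
  shows "\<bar>F_energy s N \<mu> X\<bar> \<noteq> \<infinity>"
proof -
  let ?S = "\<Sum>i<N. \<Sum>j\<in>{..<N} - {i}. g_tilde s \<mu> (X i) (X j)"
  have "\<bar>g_tilde s \<mu> (X i) (X j)\<bar> \<noteq> \<infinity>" if "i < N" "j \<in> {..<N} - {i}" for i j
    using assms that by (auto simp: g_tilde_def riesz_ext_def inj_on_def)
  then have "\<bar>?S\<bar> \<noteq> \<infinity>"
    by (simp add: sum_Inf)
  then show ?thesis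
    unfolding F_energy_def by (cases ?S) auto
qed

text \<open>One infinite summand makes an \<open>ereal\<close> sum infinite, and the remaining terms
  of the energy are real. It is used to fix the sign of the constant in the pointwise bound.\<close>

lemma F_energy_coinciding:
  assumes "i < N" "j < N" "i \<noteq> j" "X i = X j"
  shows "F_energy s N \<mu> X = \<infinity>"
proof -
  let ?S = "\<Sum>i<N. \<Sum>j\<in>{..<N} - {i}. g_tilde s \<mu> (X i) (X j)"
  have "g_tilde s \<mu> (X i) (X j) = \<infinity>"
    using assms by (simp add: g_tilde_def riesz_ext_def)
  then have "\<exists>i\<in>{..<N}. \<exists>j\<in>{..<N} - {i}. g_tilde s \<mu> (X i) (X j) = \<infinity>"
    using assms by (intro bexI[of _ i] bexI[of _ j]) auto
  then have "?S = \<infinity>"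
    by (simp add: sum_Pinfty)
  with assms show ?thesis
    unfolding F_energy_def by simp
qed

section \<open>Gibbs weights and change of measure\<close>

lemma exp_ereal_measurable [measurable]: "exp_ereal \<in> borel_measurable borel"
  unfolding exp_ereal_def[abs_def] by measurable

lemma gibbs_weight_finite_energy:
  assumes "F_energy s N \<mu> X = ereal r"
  shows "gibbs_weight s \<beta> N \<mu> X = ennreal (exp (- (\<beta> * real N * r)))"
  using assms by (simp add: gibbs_weight_def exp_ereal_def)

text \<open>The normalisation cancels because the partition function is neither 0 nor infinite. The
  product form avoids division in \<open>ennreal\<close> when the bounds on the two factors are
  combined.\<close>

lemma nn_integral_Q_gibbs:
  assumes "gibbs_weight s \<beta> N \<mu> \<in> borel_measurable (tensor_power N \<mu>)"
    and "h \<in> borel_measurable (tensor_power N \<mu>)"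
    and "K_partition s \<beta> N \<mu> \<noteq> 0" "K_partition s \<beta> N \<mu> \<noteq> \<infinity>"
  shows "K_partition s \<beta> N \<mu> * (\<integral>\<^sup>+X. h X \<partial>Q_gibbs s \<beta> N \<mu>)
    = (\<integral>\<^sup>+X. gibbs_weight s \<beta> N \<mu> X * h X \<partial>tensor_power N \<mu>)"
proof -
  note assms(1,2)[measurable]
  let ?K = "K_partition s \<beta> N \<mu>"
  have "?K * (\<integral>\<^sup>+X. h X \<partial>Q_gibbs s \<beta> N \<mu>)
      = (\<integral>\<^sup>+X. ?K * (gibbs_weight s \<beta> N \<mu> X / ?K * h X) \<partial>tensor_power N \<mu>)"
    unfolding Q_gibbs_def by (simp add: nn_integral_density nn_integral_cmult)
  also have "\<dots> = (\<integral>\<^sup>+X. gibbs_weight s \<beta> N \<mu> X * h X \<partial>tensor_power N \<mu>)"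
  proof (rule nn_integral_cong)
    fix X
    have "?K * (gibbs_weight s \<beta> N \<mu> X / ?K) = gibbs_weight s \<beta> N \<mu> X"
      using mult_divide_eq_ennreal[OF assms(3)] assms(4)
      by (simp add: ennreal_times_divide mult.commute[of ?K])
    then show "?K * (gibbs_weight s \<beta> N \<mu> X / ?K * h X) = gibbs_weight s \<beta> N \<mu> X * h X"
      by (simp add: mult.assoc[symmetric])
  qed
  finally show ?thesis .
qed

theorem corollary7p3:
  fixes \<mu> :: "'a::euclidean_space measure" and v :: "'a \<Rightarrow> 'a"
    and s \<beta> \<epsilon> C\<^sub>e\<^sub>m C\<^sub>u\<^sub>b C\<^sub>p\<^sub>w C\<^sub>p\<^sub>t :: real and n :: nat
  assumes "n \<ge> 1" and "\<beta> > 0"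
    and "0 \<le> s" and "s < real DIM('a) / 2"
    and "prob_space \<mu>" and "bounded_density \<mu>"
    and "\<exists>L. L-lipschitz_on UNIV v"
    and "s = 0 \<Longrightarrow> integrable (\<mu> \<Otimes>\<^sub>M \<mu>) (\<lambda>p. \<bar>ln (norm (fst p - snd p))\<bar>)"
    and "\<epsilon> > 0"
    and "\<And>\<sigma>. \<sigma> \<in> {1, -1} \<Longrightarrow>
           (SUP N\<in>{1..}. \<integral>\<^sup>+X. ennreal (exp (\<sigma> * \<epsilon> * real N * A_comm s n v N X \<mu>)) \<partial>Q_gibbs s \<beta> N \<mu>)
             \<le> ennreal C\<^sub>e\<^sub>m"
    and "(SUP N\<in>{1..}. K_partition s \<beta> N \<mu>) \<le> ennreal C\<^sub>u\<^sub>b"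
    and "\<And>N X. N \<ge> 1 \<Longrightarrow> X \<in> space (config_space N) \<Longrightarrow>
           ereal \<bar>A_comm s n v N X \<mu>\<bar>
             \<le> ereal C\<^sub>p\<^sub>w * (F_energy s N \<mu> X + ereal (C\<^sub>p\<^sub>t * (a_scale s DIM('a) N / real N)))"
  shows "\<forall>N\<ge>1. \<forall>f. prob_space f \<and> sets f = sets (config_space N) \<longrightarrow>
           \<bar>expect_ereal f (\<lambda>X. ereal (real N * A_comm s n v N X \<mu>))\<bar>
             \<le> min (ereal (\<beta> / \<epsilon>) * (ereal (real N) * modulated_free_energy s \<beta> N f \<mu>)
                      + ereal ((1 / \<epsilon>) * (ln (max (exp 1) C\<^sub>u\<^sub>b) + ln C\<^sub>e\<^sub>m)))
                   (ereal C\<^sub>p\<^sub>w * (ereal (real N) * modulated_free_energy s \<beta> N f \<mu>)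
                      + ereal (C\<^sub>p\<^sub>w * C\<^sub>p\<^sub>t * a_scale s DIM('a) N))"
proof (intro allI impI, elim conjE)
  fix N :: nat and f :: "(nat \<Rightarrow> 'a) measure"
  assume N: "N \<ge> 1" and f: "prob_space f" "sets f = sets (config_space N :: (nat \<Rightarrow> 'a) measure)"
  let ?\<rho> = "tensor_power N \<mu>"
  let ?w = "gibbs_weight s \<beta> N \<mu>"
  let ?K = "K_partition s \<beta> N \<mu>"
  let ?A = "\<lambda>X. A_comm s n v N X \<mu>"
  let ?G = "\<lambda>X. real_of_ereal (F_energy s N \<mu> X)"
  have \<mu>: "sets \<mu> = sets borel"
    using assms(6) by (auto simp: bounded_density_def)
  interpret \<rho>: prob_space ?\<rho>
    by (intro prob_space_PiM assms(5))
  have sets_\<rho>: "sets ?\<rho> = sets (config_space N :: (nat \<Rightarrow> 'a) measure)"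
    using \<mu> by (intro sets_PiM_cong) auto
  note sets_\<rho>[measurable_cong]
  obtain L where "L-lipschitz_on UNIV v"
    using assms(7) by blast
  then have "v \<in> borel_measurable borel"
    by (intro borel_measurable_continuous_onI lipschitz_on_continuous_on)
  then have A_meas[measurable]: "?A \<in> borel_measurable ?\<rho>"
    using A_comm_measurable[OF N assms(5) \<mu>] by (simp cong: measurable_cong_sets)
  have F_meas[measurable]: "F_energy s N \<mu> \<in> borel_measurable ?\<rho>"
    using F_energy_measurable[OF assms(5) \<mu>] by (simp cong: measurable_cong_sets)
  have w_meas[measurable]: "?w \<in> borel_measurable ?\<rho>"
    unfolding gibbs_weight_def[abs_def] by measurable
  have F_fin: "AE X in ?\<rho>. \<bar>F_energy s N \<mu> X\<bar> \<noteq> \<infinity>"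
    using AE_tensor_power_distinct[OF assms(5) \<mu> emeasure_singleton_bounded_density[OF assms(6)]]
    by eventually_elim (rule F_energy_finite)
  have w_eq: "AE X in ?\<rho>. ?w X = ennreal (exp (- (\<beta> * real N * ?G X)))"
    using F_fin by eventually_elim (simp add: gibbs_weight_finite_energy ereal_real)
  \<comment> \<open>The integrand is almost everywhere an exponential of a finite number, hence
    positive, so its integral over a probability space cannot vanish. This yields both a nonzero
    partition function and, below, positivity of \<open>C\<^sub>e\<^sub>m\<close>.\<close>
  have pos_integral: "(\<integral>\<^sup>+X. ?w X * ennreal (exp (g X)) \<partial>?\<rho>) \<noteq> 0"
    if [measurable]: "g \<in> borel_measurable ?\<rho>" for g
  proof
    assume "(\<integral>\<^sup>+X. ?w X * ennreal (exp (g X)) \<partial>?\<rho>) = 0"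
    then have "AE X in ?\<rho>. ?w X * ennreal (exp (g X)) = 0"
      by (subst (asm) nn_integral_0_iff_AE) measurable
    with w_eq have "AE X in ?\<rho>. False"
      by eventually_elim (simp add: ennreal_mult[symmetric])
    then show False
      by simp
  qed
  have K_le: "?K \<le> ennreal C\<^sub>u\<^sub>b"
    using N by (intro order_trans[OF SUP_upper assms(11)]) simp
  have K: "?K \<noteq> 0" "?K \<noteq> \<infinity>"
    using pos_integral[of "\<lambda>_. 0"] K_le by (auto simp: K_partition_def top_unique)
  have Q: "?K * (\<integral>\<^sup>+X. ennreal (exp (\<sigma> * \<epsilon> * real N * ?A X)) \<partial>Q_gibbs s \<beta> N \<mu>)
      = (\<integral>\<^sup>+X. ?w X * ennreal (exp (\<sigma> * \<epsilon> * real N * ?A X)) \<partial>?\<rho>)" for \<sigma>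
    using K by (intro nn_integral_Q_gibbs) measurable
  have Q_le: "(\<integral>\<^sup>+X. ennreal (exp (\<sigma> * \<epsilon> * real N * ?A X)) \<partial>Q_gibbs s \<beta> N \<mu>) \<le> ennreal C\<^sub>e\<^sub>m"
    if "\<sigma> \<in> {1, -1}" for \<sigma>
    using N by (intro order_trans[OF SUP_upper assms(10)[OF that]]) simp
  \<comment> \<open>A nonpositive real becomes 0 in \<open>ennreal\<close>, so the exponential
    moment under the Gibbs measure would vanish. Positivity is what lets the logarithm of the
    product of constants split.\<close>
  have C\<^sub>e\<^sub>m: "C\<^sub>e\<^sub>m > 0"
  proof (rule ccontr)
    assume "\<not> C\<^sub>e\<^sub>m > 0"
    then have "(\<integral>\<^sup>+X. ennreal (exp (1 * \<epsilon> * real N * ?A X)) \<partial>Q_gibbs s \<beta> N \<mu>) = 0"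
      using Q_le[of 1] by (simp add: ennreal_neg)
    then show False
      using Q[of 1] pos_integral[of "\<lambda>X. 1 * \<epsilon> * real N * ?A X"] by simp
  qed
  let ?C = "max (exp 1) C\<^sub>u\<^sub>b"
  have C: "?C > 0"
    by (simp add: less_max_iff_disj)
  have K_le': "?K \<le> ennreal ?C"
    using K_le by (rule order_trans) (simp add: ennreal_leI)
  \<comment> \<open>Coinciding points have infinite energy, which rules out a negative constant.\<close>
  have "C\<^sub>p\<^sub>w \<ge> 0"
  proof (rule ccontr)
    assume "\<not> C\<^sub>p\<^sub>w \<ge> 0"
    let ?X = "\<lambda>i\<in>{..<2::nat}. 0 :: 'a"
    have "F_energy s 2 \<mu> ?X = \<infinity>"
      by (rule F_energy_coinciding[of 0 _ 1]) auto
    then show False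
      using assms(12)[of 2 ?X] \<open>\<not> C\<^sub>p\<^sub>w \<ge> 0\<close> by (simp add: space_PiM)
  qed
  have "\<bar>expect_ereal f (\<lambda>X. ereal (real N * ?A X))\<bar>
      \<le> min (ereal (\<beta> / \<epsilon>) * (ereal (real N) * modulated_free_energy s \<beta> N f \<mu>)
               + ereal (1 / \<epsilon> * ln (?C * C\<^sub>e\<^sub>m)))
            (ereal C\<^sub>p\<^sub>w * (ereal (real N) * modulated_free_energy s \<beta> N f \<mu>)
               + ereal (C\<^sub>p\<^sub>w * (real N * (C\<^sub>p\<^sub>t * (a_scale s DIM('a) N / real N)))))"
    unfolding modulated_free_energy_def
  \<comment> \<open>The abstract bound is applied with \<open>k = real N\<close>,
    \<open>Z' = ?C\<close> and \<open>Z = ?C * C\<^sub>e\<^sub>m\<close>; the logarithm of this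
    product produces the additive constant in the first bound.\<close>
  proof (rule expectation_le_free_energy[OF \<rho>.prob_space_axioms f(1) _ F_meas F_fin A_meas])
    show "sets f = sets ?\<rho>"
      using f(2) sets_\<rho> by simp
    show "ereal \<bar>?A X\<bar> \<le> ereal C\<^sub>p\<^sub>w * (F_energy s N \<mu> X + ereal (C\<^sub>p\<^sub>t * (a_scale s DIM('a) N / real N)))"
      if "X \<in> space ?\<rho>" for X
      using that assms(12)[OF N] sets_eq_imp_space_eq[OF sets_\<rho>] by simp
    have "(\<integral>\<^sup>+X. ennreal (exp (- (\<beta> * real N * ?G X))) \<partial>?\<rho>) = ?K"
      unfolding K_partition_def using w_eq by (intro nn_integral_cong_AE) auto
    then show "(\<integral>\<^sup>+X. ennreal (exp (- (\<beta> * real N * ?G X))) \<partial>?\<rho>) \<le> ennreal ?C"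
      using K_le' by simp
    show "(\<integral>\<^sup>+X. ennreal (exp (\<sigma> * \<epsilon> * real N * ?A X - \<beta> * real N * ?G X)) \<partial>?\<rho>) \<le> ennreal (?C * C\<^sub>e\<^sub>m)"
      if "\<sigma> \<in> {1, -1}" for \<sigma>
    proof -
      \<comment> \<open>The exponential factors into the Gibbs weight and the tilt by the
        commutator, so the integral equals the partition function times a moment under
        \<open>Q_gibbs\<close>, and each factor has its own bound.\<close>
      have "(\<integral>\<^sup>+X. ennreal (exp (\<sigma> * \<epsilon> * real N * ?A X - \<beta> * real N * ?G X)) \<partial>?\<rho>)
          = (\<integral>\<^sup>+X. ?w X * ennreal (exp (\<sigma> * \<epsilon> * real N * ?A X)) \<partial>?\<rho>)"
        using w_eq
        by (intro nn_integral_cong_AE, eventually_elim)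
          (simp add: ennreal_mult[symmetric] exp_add[symmetric])
      also have "\<dots> \<le> ennreal ?C * ennreal C\<^sub>e\<^sub>m"
        unfolding Q[symmetric] by (intro mult_mono K_le' Q_le that) auto
      finally show ?thesis
        using C C\<^sub>e\<^sub>m by (simp add: ennreal_mult)
    qed
  qed (use assms N C C\<^sub>e\<^sub>m \<open>C\<^sub>p\<^sub>w \<ge> 0\<close> in auto)
  moreover have "ln (?C * C\<^sub>e\<^sub>m) = ln ?C + ln C\<^sub>e\<^sub>m"
    using C C\<^sub>e\<^sub>m by (simp add: ln_mult)
  moreover have "C\<^sub>p\<^sub>w * (real N * (C\<^sub>p\<^sub>t * (a_scale s DIM('a) N / real N))) = C\<^sub>p\<^sub>w * C\<^sub>p\<^sub>t * a_scale s DIM('a) N"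
    using N by simp
  ultimately show "\<bar>expect_ereal f (\<lambda>X. ereal (real N * ?A X))\<bar>
      \<le> min (ereal (\<beta> / \<epsilon>) * (ereal (real N) * modulated_free_energy s \<beta> N f \<mu>)
               + ereal ((1 / \<epsilon>) * (ln ?C + ln C\<^sub>e\<^sub>m)))
            (ereal C\<^sub>p\<^sub>w * (ereal (real N) * modulated_free_energy s \<beta> N f \<mu>)
               + ereal (C\<^sub>p\<^sub>w * C\<^sub>p\<^sub>t * a_scale s DIM('a) N))"
    by (simp only:)
qed

end
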